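(* Let $p_i,q_i$ ($i=0,1,\ldots$) be the numerators and denominators of the convergents of a continued fraction of the form $$\sqrt N=[c_0,\overline{c_1,c_2,\ldots,c_2,c_1,2c_0}]$$ with period length $l\ge1$ (so that $p_{l-1}^2-Nq_{l-1}^2=(-1)^l$). Then for all integers $k\ge 0$, $$p_{kl-1}=T^l_k(p_{l-1}),\qquad q_{kl-1}=q_{l-1}\,U^l_{k-1}(p_{l-1}),$$ where $T^l_k$ and $U^l_k$ are the signed Chebyshev polynomials of the first and second kind.
   Context: The continued fraction is either the simple continued fraction of a real number (integer partial quotients $c_i$) or a continued fraction of a complex number with Gaussian integer partial quotients (e.g. the Hurwitz continued fraction). The displayed form means: $c_{i+l}=c_i$ for all $i\ge1$, $c_l=2c_0$, and $c_i=c_{l-i}$ for $1\le i\le l-1$. The convergents $p_m/q_m=[c_0,\ldots,c_m]$ are given by $$\begin{pmatrix} c_0 & 1 \\ 1 & 0 \end{pmatrix}\begin{pmatrix} c_1 & 1 \\ 1 & 0 \end{pmatrix}\cdots\begin{pmatrix} c_m & 1 \\ 1 & 0 \end{pmatrix}=\begin{pmatrix} p_m & p_{m-1} \\ q_m & q_{m-1} \end{pmatrix},\qquad m\ge0,$$ so $p_{-1}=1$, $q_{-1}=0$. Signed Chebyshev polynomials: $T^l_0=1$, $T^l_1=x$, $T^l_{k+2}=2xT^l_{k+1}-(-1)^lT^l_k$; $U^l_0=1$, $U^l_1=2x$, $U^l_{k+2}=2xU^l_{k+1}-(-1)^lU^l_k$; and by extending the recurrence backwards $U^l_{-1}=0$.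 *)

theory Defs
  imports "HOL-Analysis.Analysis" "HOL-Computational_Algebra.Polynomial"
begin

definition cf_factor :: "'a::comm_ring_1 \<Rightarrow> 'a^2^2" where
  "cf_factor a = vector [vector [a, 1], vector [1, 0]]"

text \<open>\<open>cf_matrix c n\<close> is the product of the first \<open>n\<close> factors, belonging to
  \<open>c 0, \<dots>, c (n - 1)\<close>.\<close>

primrec cf_matrix :: "(nat \<Rightarrow> 'a::comm_ring_1) \<Rightarrow> nat \<Rightarrow> 'a^2^2" where
  "cf_matrix c 0 = mat 1"
| "cf_matrix c (Suc n) = cf_matrix c n ** cf_factor (c n)"

text \<open>Convergents are indexed by integers \<open>m \<ge> -1\<close>; the empty product gives
  \<open>p\<^sub>m = 1\<close>, \<open>q\<^sub>m = 0\<close> at \<open>m = -1\<close>. Values at \<open>m < -1\<close> are irrelevant.\<close>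

definition cf_num :: "(nat \<Rightarrow> 'a::comm_ring_1) \<Rightarrow> int \<Rightarrow> 'a" where
  "cf_num c m = cf_matrix c (nat (m + 1)) $ 1 $ 1"

definition cf_den :: "(nat \<Rightarrow> 'a::comm_ring_1) \<Rightarrow> int \<Rightarrow> 'a" where
  "cf_den c m = cf_matrix c (nat (m + 1)) $ 2 $ 1"

lemma cf_num_minus_one: "cf_num c (-1) = 1"
  and cf_den_minus_one: "cf_den c (-1) = 0"
  by (simp_all add: cf_num_def cf_den_def mat_def)

lemma cf_matrix_convergents:
  "cf_matrix c (Suc m) =
     vector [vector [cf_num c (int m), cf_num c (int m - 1)],
             vector [cf_den c (int m), cf_den c (int m - 1)]]"
  by (simp add: vec_eq_iff forall_2 cf_num_def cf_den_def cf_factor_def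
      matrix_matrix_mult_def sum_2 nat_add_distrib)

text \<open>The infinite continued fraction \<open>[c 0, c 1, \<dots>]\<close> has the value \<open>z\<close>. The
  condition on the denominators is needed because division by zero is total.\<close>

definition cf_has_value :: "(nat \<Rightarrow> 'a::real_normed_field) \<Rightarrow> 'a \<Rightarrow> bool" where
  "cf_has_value c z \<longleftrightarrow>
     (\<forall>\<^sub>F n in sequentially. cf_den c (int n) \<noteq> 0) \<and>
     (\<lambda>n. cf_num c (int n) / cf_den c (int n)) \<longlonglongrightarrow> z"

definition simple_cf_of :: "(nat \<Rightarrow> int) \<Rightarrow> real \<Rightarrow> bool" where
  "simple_cf_of a x \<longleftrightarrow> (\<forall>i\<ge>1. a i \<ge> 1) \<and> cf_has_value (\<lambda>i. of_int (a i)) x"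

definition gaussian_integers :: "complex set" where
  "gaussian_integers = {z. Re z \<in> \<int> \<and> Im z \<in> \<int>}"

definition gaussian_cf_of :: "(nat \<Rightarrow> complex) \<Rightarrow> complex \<Rightarrow> bool" where
  "gaussian_cf_of c z \<longleftrightarrow> (\<forall>i. c i \<in> gaussian_integers) \<and> cf_has_value c z"

text \<open>The shape \<open>[c\<^sub>0, c\<^sub>1, c\<^sub>2, \<dots>, c\<^sub>2, c\<^sub>1, 2c\<^sub>0, \<dots>]\<close>, repeating after \<open>c\<^sub>0\<close> with
  period length \<open>l\<close>, which need not be minimal.\<close>

definition cf_sqrt_form :: "(nat \<Rightarrow> 'a::comm_ring_1) \<Rightarrow> nat \<Rightarrow> bool" where
  "cf_sqrt_form c l \<longleftrightarrow>
     (\<forall>i\<ge>1. c (i + l) = c i) \<and> c l = 2 * c 0 \<and> (\<forall>i\<in>{1..l - 1}. c i = c (l - i))"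

fun signed_cheb_T :: "nat \<Rightarrow> nat \<Rightarrow> 'a::comm_ring_1 poly" where
  "signed_cheb_T l 0 = 1"
| "signed_cheb_T l (Suc 0) = [:0, 1:]"
| "signed_cheb_T l (Suc (Suc k)) =
     [:0, 2:] * signed_cheb_T l (Suc k) - (-1) ^ l * signed_cheb_T l k"

fun signed_cheb_U_nat :: "nat \<Rightarrow> nat \<Rightarrow> 'a::comm_ring_1 poly" where
  "signed_cheb_U_nat l 0 = 1"
| "signed_cheb_U_nat l (Suc 0) = [:0, 2:]"
| "signed_cheb_U_nat l (Suc (Suc k)) =
     [:0, 2:] * signed_cheb_U_nat l (Suc k) - (-1) ^ l * signed_cheb_U_nat l k"

text \<open>Indexed by integers \<open>k \<ge> -1\<close>; the value \<open>0\<close> at \<open>k = -1\<close> is the one forced by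
  running the recurrence backwards. Values at \<open>k < -1\<close> are irrelevant.\<close>

definition signed_cheb_U :: "nat \<Rightarrow> int \<Rightarrow> 'a::comm_ring_1 poly" where
  "signed_cheb_U l k = (if k < 0 then 0 else signed_cheb_U_nat l (nat k))"

lemma signed_cheb_U_rec:
  assumes "k \<ge> -1"
  shows "signed_cheb_U l (k + 2) =
           [:0, 2:] * signed_cheb_U l (k + 1) - (-1) ^ l * signed_cheb_U l k"
proof (cases "k = -1")
  case True
  then show ?thesis by (simp add: signed_cheb_U_def)
next
  case False
  with assms have "k \<ge> 0" by simp
  then obtain n where "k = int n" by (metis nonneg_int_cases)
  then show ?thesis by (simp add: signed_cheb_U_def nat_add_distrib)
qed

end

theory Submission imports Defs begin

text \<open>Let \<open>A\<close> be the product of the factors of \<open>c\<^sub>0, \<dots>, c\<^bsub>l-1\<^esub>\<close> and \<open>E\<close> the unipotent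
  matrix with rows \<open>(1, c\<^sub>0)\<close> and \<open>(0, 1)\<close>. The factor of \<open>2c\<^sub>0\<close> is \<open>E\<close> times that of \<open>c\<^sub>0\<close>, so
  advancing the index by a period multiplies the column \<open>(p, q)\<close> on the left by \<open>AE\<close>. Since
  \<open>A\<close> times the factor of \<open>c\<^sub>0\<close> is a palindromic product of symmetric matrices, both diagonal
  entries of \<open>AE\<close> equal \<open>p\<^bsub>l-1\<^esub>\<close>; its lower left entry is \<open>q\<^bsub>l-1\<^esub>\<close> and its determinant is
  \<open>(-1)\<^sup>l\<close>. By Cayley--Hamilton \<open>p\<^bsub>kl-1\<^esub>\<close> and \<open>q\<^bsub>kl-1\<^esub>\<close> satisfy the recurrence of the signed
  Chebyshev polynomials. The convergents at these indices are iterates of the Moebius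
  map of \<open>AE\<close>, so their limit is a fixed point of it, which identifies the upper right
  entry of \<open>AE\<close> as \<open>N q\<^bsub>l-1\<^esub>\<close>.\<close>

lemma cf_factor_nth [simp]:
  "cf_factor a $ 1 $ 1 = a" "cf_factor a $ 1 $ 2 = 1"
  "cf_factor a $ 2 $ 1 = 1" "cf_factor a $ 2 $ 2 = 0"
  by (simp_all add: cf_factor_def)

lemma transpose_cf_factor: "transpose (cf_factor a) = cf_factor a"
  by (simp add: vec_eq_iff forall_2 transpose_def)

lemma matrix_mult_2_nth:
  "((A :: 'a::comm_ring_1^2^2) ** B) $ i $ j = A $ i $ 1 * B $ 1 $ j + A $ i $ 2 * B $ 2 $ j"
  by (simp add: matrix_matrix_mult_def sum_2)

lemma cf_matrix_cong:
  assumes "\<And>i. i < n \<Longrightarrow> c i = d i"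
  shows "cf_matrix c n = cf_matrix d n"
  using assms by (induction n) auto

lemma cf_matrix_add:
  "cf_matrix c (m + n) = cf_matrix c m ** cf_matrix (\<lambda>i. c (m + i)) n"
  by (induction n) (simp_all add: matrix_mul_assoc)

lemma cf_matrix_Suc_left:
  "cf_matrix c (Suc n) = cf_factor (c 0) ** cf_matrix (\<lambda>i. c (Suc i)) n"
  using cf_matrix_add[of c 1 n] by simp

text \<open>Each factor is symmetric, so transposing only reverses the order of the product.\<close>

lemma transpose_cf_matrix:
  "transpose (cf_matrix c n) = cf_matrix (\<lambda>i. c (n - 1 - i)) n"
proof (induction n)
  case 0
  show ?case by simp
next
  case (Suc n)
  have "transpose (cf_matrix c (Suc n))
      = cf_factor (c n) ** cf_matrix (\<lambda>i. c (n - 1 - i)) n"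
    by (simp add: matrix_transpose_mul transpose_cf_factor Suc)
  also have "\<dots> = cf_matrix (\<lambda>i. c (Suc n - 1 - i)) (Suc n)"
    by (subst cf_matrix_Suc_left) simp
  finally show ?case .
qed

lemma det_cf_matrix: "det (cf_matrix c n) = (-1) ^ n"
  by (induction n) (simp_all add: det_mul det_2[of "cf_factor _"])

lemma cf_matrix_of_real:
  "cf_matrix (\<lambda>i. of_real (c i) :: 'a::{real_algebra_1,comm_ring_1}) n $ i $ j
     = of_real (cf_matrix c n $ i $ j)"
proof (induction n arbitrary: j)
  case 0
  show ?case by (simp add: mat_def)
next
  case (Suc n)
  have "j = 1 \<or> j = 2" by (rule exhaust_2)
  with Suc show ?case by (auto simp: matrix_mult_2_nth)
qed

text \<open>Embeds the simple continued fraction of a real number into the complex setting of the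
  theorem.\<close>

lemma cf_has_value_of_real:
  assumes "cf_has_value c x"
  shows "cf_has_value (\<lambda>i. of_real (c i) :: 'a::real_normed_field) (of_real x)"
  using assms
  by (simp add: cf_has_value_def cf_num_def cf_den_def cf_matrix_of_real tendsto_of_real_iff
      flip: of_real_divide)

context
  fixes c :: "nat \<Rightarrow> 'a::comm_ring_1" and l :: nat
  assumes l: "l \<ge> 1" and form: "cf_sqrt_form c l"
begin

lemma cf_matrix_diag_eq:
  "cf_matrix c l $ 2 $ 1 * c 0 + cf_matrix c l $ 2 $ 2 = cf_matrix c l $ 1 $ 1"
proof -
  \<comment> \<open>Lowering the entry \<open>2 * c 0\<close> at index \<open>l\<close> to
    \<open>c 0\<close> makes \<open>d 0, ..., d l\<close> a full palindrome.\<close>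
  define d where "d = c(l := c 0)"
  define S where "S = cf_matrix d (Suc l)"
  have sym: "d (Suc l - 1 - i) = d i" if "i < Suc l" for i
  proof (cases "i = 0 \<or> i = l")
    case False
    then have "c i = c (l - i)"
      using that form unfolding cf_sqrt_form_def by auto
    then show ?thesis using that False by (auto simp: d_def)
  qed (auto simp: d_def)
  have "cf_matrix d l = cf_matrix c l"
    by (rule cf_matrix_cong) (simp add: d_def)
  then have S: "S = cf_matrix c l ** cf_factor (c 0)"
    by (simp add: S_def d_def)
  have "transpose S = S"
    unfolding S_def transpose_cf_matrix by (rule cf_matrix_cong) (rule sym)
  then have "transpose S $ 1 $ 2 = S $ 1 $ 2" by simp
  then have "S $ 2 $ 1 = S $ 1 $ 2" by (simp add: transpose_def)
  then show ?thesis by (simp add: S matrix_mult_2_nth)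
qed

definition upper_entry :: 'a where
  "upper_entry = cf_matrix c l $ 1 $ 1 * c 0 + cf_matrix c l $ 1 $ 2"

lemma cf_matrix_period_mult:
  "cf_matrix c (l + n) $ 1 $ 1
     = cf_matrix c l $ 1 $ 1 * cf_matrix c n $ 1 $ 1 + upper_entry * cf_matrix c n $ 2 $ 1"
  "cf_matrix c (l + n) $ 2 $ 1
     = cf_matrix c l $ 2 $ 1 * cf_matrix c n $ 1 $ 1 + cf_matrix c l $ 1 $ 1 * cf_matrix c n $ 2 $ 1"
proof -
  have "cf_matrix c (l + n) $ i $ 1
      = cf_matrix c l $ i $ 1 * cf_matrix c n $ 1 $ 1
        + (cf_matrix c l $ i $ 1 * c 0 + cf_matrix c l $ i $ 2) * cf_matrix c n $ 2 $ 1" for i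
  proof (cases n)
    case 0
    then show ?thesis by (simp add: mat_def)
  next
    case (Suc m)
    \<comment> \<open>Periodicity starts at index 1, so the factor of \<open>c l\<close> is split
      off; the excess of \<open>2 * c 0\<close> over \<open>c 0\<close> produces
      \<open>E\<close>.\<close>
    have "(\<lambda>i. c (l + Suc i)) = (\<lambda>i. c (Suc i))"
      using form unfolding cf_sqrt_form_def by (metis add.commute plus_1_eq_Suc le_add1)
    moreover have "c l = 2 * c 0" using form by (simp add: cf_sqrt_form_def)
    ultimately show ?thesis
      unfolding Suc cf_matrix_add cf_matrix_Suc_left
      by (simp add: matrix_mult_2_nth algebra_simps)
  qed
  from this[of 1] this[of 2] show
    "cf_matrix c (l + n) $ 1 $ 1
     = cf_matrix c l $ 1 $ 1 * cf_matrix c n $ 1 $ 1 + upper_entry * cf_matrix c n $ 2 $ 1"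
    "cf_matrix c (l + n) $ 2 $ 1
     = cf_matrix c l $ 2 $ 1 * cf_matrix c n $ 1 $ 1 + cf_matrix c l $ 1 $ 1 * cf_matrix c n $ 2 $ 1"
    by (simp_all only: upper_entry_def cf_matrix_diag_eq)
qed

lemma cf_num_den_period:
  "cf_num c (int (Suc k) * int l - 1)
     = cf_num c (int l - 1) * cf_num c (int k * int l - 1)
       + upper_entry * cf_den c (int k * int l - 1)"
  "cf_den c (int (Suc k) * int l - 1)
     = cf_den c (int l - 1) * cf_num c (int k * int l - 1)
       + cf_num c (int l - 1) * cf_den c (int k * int l - 1)"
  using cf_matrix_period_mult[of "k * l"]
  by (simp_all add: cf_num_def cf_den_def nat_mult_distrib nat_add_distrib flip: of_nat_mult of_nat_add of_nat_Suc)

text \<open>Since \<open>det E = 1\<close>, this is \<open>det_cf_matrix\<close> with the lower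
  right entry eliminated by \<open>cf_matrix_diag_eq\<close>.\<close>

lemma upper_entry_det:
  "(cf_num c (int l - 1))\<^sup>2 - upper_entry * cf_den c (int l - 1) = (-1) ^ l"
proof -
  let ?A = "cf_matrix c l"
  have d: "?A $ 2 $ 2 = ?A $ 1 $ 1 - ?A $ 2 $ 1 * c 0"
    using cf_matrix_diag_eq by (simp add: algebra_simps)
  have "?A $ 1 $ 1 * ?A $ 2 $ 2 - ?A $ 1 $ 2 * ?A $ 2 $ 1 = (-1) ^ l"
    using det_cf_matrix[of c l] by (simp add: det_2)
  then show ?thesis
    unfolding d by (simp add: cf_num_def cf_den_def upper_entry_def algebra_simps power2_eq_square)
qed

lemma cf_num_den_recurrence:
  assumes "f \<in> {cf_num c, cf_den c}"
  shows "f (int (Suc (Suc k)) * int l - 1)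
     = 2 * cf_num c (int l - 1) * f (int (Suc k) * int l - 1) - (-1) ^ l * f (int k * int l - 1)"
proof -
  consider "f = cf_num c" | "f = cf_den c" using assms by blast
  then show ?thesis
    \<comment> \<open>With \<open>(-1) ^ l\<close> written as the determinant, expanding both period
      steps leaves a polynomial identity.\<close>
    unfolding upper_entry_det[symmetric]
    by cases (simp_all only: cf_num_den_period, simp_all add: algebra_simps power2_eq_square)
qed

lemma cf_num_eq_cheb:
  "cf_num c (int k * int l - 1) = poly (signed_cheb_T l k) (cf_num c (int l - 1))"
proof (induction k rule: induct_nat_012)
  case (ge2 k)
  show ?case
    using cf_num_den_recurrence[of "cf_num c" k] ge2
    by (simp del: of_nat_Suc)
qed (simp_all add: cf_num_minus_one)

lemma cf_den_eq_cheb: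
  "cf_den c (int k * int l - 1)
     = cf_den c (int l - 1) * poly (signed_cheb_U l (int k - 1)) (cf_num c (int l - 1))"
proof (induction k rule: induct_nat_012)
  case (ge2 k)
  \<comment> \<open>For \<open>k = 0\<close> this instance of the recurrence uses the backward value
    \<open>0\<close> at index \<open>-1\<close>.\<close>
  have U: "poly (signed_cheb_U l (1 + int k)) x
      = 2 * x * poly (signed_cheb_U l (int k)) x - (-1) ^ l * poly (signed_cheb_U l (int k - 1)) x"
    for x :: 'a
    using signed_cheb_U_rec[of "int k - 1" l, where 'a = 'a] by (simp add: add.commute)
  show ?case
    using cf_num_den_recurrence[of "cf_den c" k] unfolding ge2 by (simp add: U algebra_simps)
qed (simp_all add: cf_den_minus_one signed_cheb_U_def)

end

lemma upper_entry_eq_value: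
  fixes c :: "nat \<Rightarrow> 'a::real_normed_field"
  assumes l: "l \<ge> 1" and form: "cf_sqrt_form c l" and val: "cf_has_value c s"
  shows "upper_entry c l = s\<^sup>2 * cf_den c (int l - 1)"
proof -
  define p q where "p = cf_num c (int l - 1)" and "q = cf_den c (int l - 1)"
  define P where "P k = cf_num c (int (Suc k) * int l - 1)" for k
  define Q where "Q k = cf_den c (int (Suc k) * int l - 1)" for k
  \<comment> \<open>Starting at \<open>Suc k\<close> skips the convergent of index
    \<open>-1\<close>, whose denominator is 0.\<close>
  define r where "r k = Suc k * l - 1" for k
  have idx: "int (Suc k) * int l - 1 = int (r k)" for k
  proof -
    have "1 \<le> Suc k * l" using l by simp
    then show ?thesis by (simp only: r_def of_nat_diff of_nat_mult of_nat_1)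
  qed
  have mono: "strict_mono r"
    unfolding strict_mono_Suc_iff
  proof
    show "r k < r (Suc k)" for k using l by (simp add: r_def)
  qed
  have lim: "(\<lambda>k. P k / Q k) \<longlonglongrightarrow> s"
    using LIMSEQ_subseq_LIMSEQ[OF conjunct2[OF val[unfolded cf_has_value_def]] mono]
    unfolding P_def Q_def idx by (simp add: o_def)
  have nz: "\<forall>\<^sub>F k in sequentially. Q k \<noteq> 0"
    using eventually_subseq[OF mono conjunct1[OF val[unfolded cf_has_value_def]]]
    unfolding Q_def idx .
  have nz': "\<forall>\<^sub>F k in sequentially. Q (Suc k) \<noteq> 0"
    by (subst eventually_sequentially_Suc) (rule nz)
  \<comment> \<open>The Moebius relation is cleared of its denominator, so that passing to the limit
    involves no division by \<open>q * s + p\<close>.\<close>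
  have "\<forall>\<^sub>F k in sequentially.
      P (Suc k) / Q (Suc k) * (q * (P k / Q k) + p) = p * (P k / Q k) + upper_entry c l"
    using nz nz'
  proof eventually_elim
    case (elim k)
    have step: "P (Suc k) = p * P k + upper_entry c l * Q k" "Q (Suc k) = q * P k + p * Q k"
      unfolding P_def Q_def p_def q_def by (rule cf_num_den_period[OF l form])+
    have "q * (P k / Q k) + p = Q (Suc k) / Q k"
      "p * (P k / Q k) + upper_entry c l = P (Suc k) / Q k"
      using elim(1) by (simp_all add: step add_divide_distrib)
    with elim(2) show ?case by simp
  qed
  moreover have "(\<lambda>k. P (Suc k) / Q (Suc k) * (q * (P k / Q k) + p)) \<longlonglongrightarrow> s * (q * s + p)"
    by (intro tendsto_intros lim LIMSEQ_Suc[OF lim])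
  ultimately have "(\<lambda>k. p * (P k / Q k) + upper_entry c l) \<longlonglongrightarrow> s * (q * s + p)"
    by (rule Lim_transform_eventually[rotated])
  moreover have "(\<lambda>k. p * (P k / Q k) + upper_entry c l) \<longlonglongrightarrow> p * s + upper_entry c l"
    by (intro tendsto_intros lim)
  ultimately have "s * (q * s + p) = p * s + upper_entry c l"
    by (rule LIMSEQ_unique)
  \<comment> \<open>The terms \<open>p * s\<close> cancel because the diagonal entries
    agree.\<close>
  then show ?thesis by (simp add: q_def algebra_simps power2_eq_square)
qed

theorem theorem4p1:
  fixes c :: "nat \<Rightarrow> complex" and s N :: complex and l :: nat
  assumes "s\<^sup>2 = N"
    and "(\<exists>a x. simple_cf_of a x \<and> c = (\<lambda>i. of_int (a i)) \<and> s = complex_of_real x)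
         \<or> gaussian_cf_of c s"
    and "l \<ge> 1"
    and "cf_sqrt_form c l"
  shows "(cf_num c (int l - 1))\<^sup>2 - N * (cf_den c (int l - 1))\<^sup>2 = (-1) ^ l
    \<and> (\<forall>k::nat.
          cf_num c (int k * int l - 1) = poly (signed_cheb_T l k) (cf_num c (int l - 1))
        \<and> cf_den c (int k * int l - 1)
            = cf_den c (int l - 1) * poly (signed_cheb_U l (int k - 1)) (cf_num c (int l - 1)))"
proof -
  have "cf_has_value c s"
    using assms(2)
  proof
    assume "\<exists>a x. simple_cf_of a x \<and> c = (\<lambda>i. of_int (a i)) \<and> s = complex_of_real x"
    then obtain a x where "cf_has_value (\<lambda>i. real_of_int (a i)) x"
      and c: "c = (\<lambda>i. of_int (a i))" and s: "s = complex_of_real x"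
      unfolding simple_cf_of_def by blast
    from cf_has_value_of_real[OF this(1), where 'a = complex] show ?thesis
      by (simp add: c s)
  qed (simp add: gaussian_cf_of_def)
  with assms upper_entry_eq_value[of l c s]
  have "upper_entry c l * cf_den c (int l - 1) = N * (cf_den c (int l - 1))\<^sup>2"
    by (simp add: power2_eq_square)
  with upper_entry_det[OF assms(3,4)] show ?thesis
    using cf_num_eq_cheb[OF assms(3,4)] cf_den_eq_cheb[OF assms(3,4)] by simp
qed

end
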